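(* Let $(X,\mu,\mathcal{E},\mathcal{F})$ be a strictly local regular Dirichlet space with intrinsic metric $d$, such that $(X,d)$ is complete, $\mu$ is volume doubling and the $2$-Poincaré inequality holds. Suppose that for some $Q>0$ and $C_1>0$ the volume growth condition $\mu(B(x,r))\ge C_1r^Q$ holds for all $x\in X$, $r\ge0$. Let $0<\delta<Q$ and $1\le p<\frac{Q}{\delta}$. Then there exists a constant $C_{p,\delta}>0$ such that for every $f\in\mathbf{B}^{p,\delta/2}(X)$, $$\sup_{s\ge0}s\,\mu(\{x\in X:|f(x)|\ge s\})^{\frac1q}\le C_{p,\delta}\sup_{r>0}\frac{1}{r^{\delta+Q/p}}\Big(\iint_{\{(x,y)\in X\times X:\ d(x,y)<r\}}|f(x)-f(y)|^p\,d\mu(x)\,d\mu(y)\Big)^{\frac1p},$$ where $q=\frac{pQ}{Q-p\delta}$. Furthermore, for every $0<\delta<Q$ there exists a constant $C_{\mathrm{iso},\delta}$ such that for every measurable $E\subset X$ with $\mu(E)<+\infty$, $$\mu(E)^{\frac{Q-\delta}{Q}}\le C_{\mathrm{iso},\delta}\sup_{r>0}\frac{1}{r^{\delta+Q}}(\mu\otimes\mu)\{(x,y)\in E\times E^c: d(x,y)\le r\}.$$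
   Context: Setting. $X$ is a separable, locally compact topological space with a Radon measure $\mu$ of full support, and $(\mathcal{E},\mathcal{F})$ is a strongly local regular Dirichlet form on $L^2(X,\mu)$. For $u,v\in\mathcal{F}$ the energy measure $\Gamma(u,v)$ is the signed Radon measure determined for bounded $u,v$ by $\int\phi\,d\Gamma(u,v)=\frac12[\mathcal{E}(\phi u,v)+\mathcal{E}(\phi v,u)-\mathcal{E}(\phi,uv)]$, $\phi\in\mathcal{F}\cap C_c(X)$, and extended to $\mathcal{F}$ by truncation; $\mathcal{E}(u,v)=\int_X d\Gamma(u,v)$. The intrinsic metric is $d(x,y)=\sup\{u(x)-u(y): u\in\mathcal{F}\cap C_0(X),\ d\Gamma(u,u)\le d\mu\}$. Strictly local means that $d$ is a metric inducing the topology of $X$. $B(x,r)$ denotes a $d$-ball. Volume doubling: there is $C>0$ with $\mu(B(x,2r))\le C\mu(B(x,r))$ for all $x\in X$, $r>0$. $2$-Poincaré inequality: there are $C>0$, $\lambda\ge1$ such that for every ball $B$ and $u\in\mathcal{F}$, $\frac1{\mu(B)}\int_B|u-u_B|\,d\mu\le C\,\mathrm{rad}(B)\big(\frac{1}{\mu(\lambda B)}\int_{\lambda B}d\Gamma(u,u)\big)^{1/2}$, with $u_B=\frac1{\mu(B)}\int_B u\,d\mu$. Heat kernel and Besov class. $p_t(x,y)$ is the heat kernel of the semigroup associated with $(\mathcal{E},\mathcal{F})$, which in this setting is known to exist and satisfy the two-sided Gaussian bounds $\frac{1}{C}\frac{e^{-c_1d(x,y)^2/t}}{\mu(B(x,\sqrt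 t))}\le p_t(x,y)\le C\frac{e^{-c_2d(x,y)^2/t}}{\mu(B(x,\sqrt t))}$. For $p\ge1$, $\alpha\ge0$ and $f\in L^p(X)$, $\|f\|_{p,\alpha}=\sup_{t>0}t^{-\alpha}\big(\int_X\int_Xp_t(x,y)|f(x)-f(y)|^p\,d\mu(x)d\mu(y)\big)^{1/p}$, and $\mathbf{B}^{p,\alpha}(X)=\{f\in L^p(X):\|f\|_{p,\alpha}<\infty\}$. *)

theory Defs
  imports "HOL-Analysis.Analysis"
begin

text \<open>Elements of \<open>L\<^sup>p\<close> are represented by Borel functions; equality in
  \<open>L\<^sup>p\<close> is equality almost everywhere, and every notion below respects it.\<close>

definition Lp :: "'a measure \<Rightarrow> real \<Rightarrow> ('a \<Rightarrow> real) set" where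
  "Lp M p = {f \<in> borel_measurable M. integrable M (\<lambda>x. \<bar>f x\<bar> powr p)}"

definition l2_inner :: "'a measure \<Rightarrow> ('a \<Rightarrow> real) \<Rightarrow> ('a \<Rightarrow> real) \<Rightarrow> real" where
  "l2_inner M u v = (\<integral>x. u x * v x \<partial>M)"

definition l2_norm :: "'a measure \<Rightarrow> ('a \<Rightarrow> real) \<Rightarrow> real" where
  "l2_norm M u = sqrt (l2_inner M u u)"

definition Cc :: "('a::topological_space \<Rightarrow> real) set" where
  "Cc = {u. continuous_on UNIV u \<and> compact (closure {x. u x \<noteq> 0})}"

text \<open>\<open>C\<^sub>0\<close> is the uniform closure of \<open>C\<^sub>c\<close>: the continuous functions vanishing at infinity.\<close>

definition C0 :: "('a::topological_space \<Rightarrow> real) set" where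
  "C0 = {u. continuous_on UNIV u \<and>
            (\<forall>\<epsilon>>0. \<exists>K. compact K \<and> (\<forall>x. x \<notin> K \<longrightarrow> \<bar>u x\<bar> < \<epsilon>))}"

definition radon_measure :: "'a::topological_space measure \<Rightarrow> bool" where
  "radon_measure M \<longleftrightarrow>
     sets M = sets borel \<and>
     (\<forall>K. compact K \<longrightarrow> emeasure M K < \<infinity>) \<and>
     (\<forall>A\<in>sets borel. emeasure M A = (INF U\<in>{U. open U \<and> A \<subseteq> U}. emeasure M U)) \<and>
     (\<forall>U. open U \<longrightarrow> emeasure M U = (SUP K\<in>{K. compact K \<and> K \<subseteq> U}. emeasure M K))"

definition full_support :: "'a::topological_space measure \<Rightarrow> bool" where
  "full_support M \<longleftrightarrow> (\<forall>U. open U \<longrightarrow> U \<noteq> {} \<longrightarrow> 0 < emeasure M U)"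

text \<open>The support of the measure with density \<open>u\<close> with respect to \<open>M\<close>; it only depends on the
  class of \<open>u\<close> and, when \<open>M\<close> has full support, agrees with the usual support for continuous \<open>u\<close>.\<close>

definition ae_support :: "'a::topological_space measure \<Rightarrow> ('a \<Rightarrow> real) \<Rightarrow> 'a set" where
  "ae_support M u = {x. \<forall>U. open U \<longrightarrow> x \<in> U \<longrightarrow> \<not> (AE y in M. y \<in> U \<longrightarrow> u y = 0)}"


definition symmetric_form ::
  "'a measure \<Rightarrow> (('a \<Rightarrow> real) \<Rightarrow> ('a \<Rightarrow> real) \<Rightarrow> real) \<Rightarrow> ('a \<Rightarrow> real) set \<Rightarrow> bool" where
  "symmetric_form M E F \<longleftrightarrow>
     F \<subseteq> Lp M 2 \<and>
     (\<forall>u\<in>F. \<forall>v\<in>borel_measurable M. (AE x in M. u x = v x) \<longrightarrow>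
        v \<in> F \<and> (\<forall>w\<in>F. E u w = E v w)) \<and>
     (\<lambda>x. 0) \<in> F \<and>
     (\<forall>u\<in>F. \<forall>v\<in>F. \<forall>a b. (\<lambda>x. a * u x + b * v x) \<in> F) \<and>
     (\<forall>u\<in>F. \<forall>v\<in>F. \<forall>w\<in>F. \<forall>a b. E (\<lambda>x. a * u x + b * v x) w = a * E u w + b * E v w) \<and>
     (\<forall>u\<in>F. \<forall>v\<in>F. E u v = E v u) \<and>
     (\<forall>u\<in>F. 0 \<le> E u u)"

definition densely_defined :: "'a measure \<Rightarrow> ('a \<Rightarrow> real) set \<Rightarrow> bool" where
  "densely_defined M F \<longleftrightarrow>
     (\<forall>f\<in>Lp M 2. \<forall>\<epsilon>>0. \<exists>u\<in>F. l2_norm M (\<lambda>x. f x - u x) < \<epsilon>)"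

definition form_norm ::
  "'a measure \<Rightarrow> (('a \<Rightarrow> real) \<Rightarrow> ('a \<Rightarrow> real) \<Rightarrow> real) \<Rightarrow> ('a \<Rightarrow> real) \<Rightarrow> real" where
  "form_norm M E u = sqrt (E u u + l2_inner M u u)"

definition closed_form ::
  "'a measure \<Rightarrow> (('a \<Rightarrow> real) \<Rightarrow> ('a \<Rightarrow> real) \<Rightarrow> real) \<Rightarrow> ('a \<Rightarrow> real) set \<Rightarrow> bool" where
  "closed_form M E F \<longleftrightarrow>
     (\<forall>U :: nat \<Rightarrow> 'a \<Rightarrow> real.
        (\<forall>n. U n \<in> F) \<longrightarrow>
        (\<forall>\<epsilon>>0. \<exists>N. \<forall>m\<ge>N. \<forall>n\<ge>N. form_norm M E (\<lambda>x. U m x - U n x) < \<epsilon>) \<longrightarrow>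
        (\<exists>u\<in>F. (\<lambda>n. form_norm M E (\<lambda>x. U n x - u x)) \<longlonglongrightarrow> 0))"

definition markovian_form ::
  "(('a \<Rightarrow> real) \<Rightarrow> ('a \<Rightarrow> real) \<Rightarrow> real) \<Rightarrow> ('a \<Rightarrow> real) set \<Rightarrow> bool" where
  "markovian_form E F \<longleftrightarrow>
     (\<forall>u\<in>F. let v = (\<lambda>x. min (max (u x) 0) 1) in v \<in> F \<and> E v v \<le> E u u)"

definition dirichlet_form ::
  "'a measure \<Rightarrow> (('a \<Rightarrow> real) \<Rightarrow> ('a \<Rightarrow> real) \<Rightarrow> real) \<Rightarrow> ('a \<Rightarrow> real) set \<Rightarrow> bool" where
  "dirichlet_form M E F \<longleftrightarrow>
     symmetric_form M E F \<and> densely_defined M F \<and> closed_form M E F \<and> markovian_form E F"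

definition regular_form ::
  "'a::topological_space measure \<Rightarrow> (('a \<Rightarrow> real) \<Rightarrow> ('a \<Rightarrow> real) \<Rightarrow> real) \<Rightarrow>
     ('a \<Rightarrow> real) set \<Rightarrow> bool" where
  "regular_form M E F \<longleftrightarrow>
     (\<forall>u\<in>F. \<forall>\<epsilon>>0. \<exists>\<phi>\<in>F \<inter> Cc. form_norm M E (\<lambda>x. u x - \<phi> x) < \<epsilon>) \<and>
     (\<forall>f\<in>Cc. \<forall>\<epsilon>>0. \<exists>\<phi>\<in>F \<inter> Cc. \<forall>x. \<bar>f x - \<phi> x\<bar> < \<epsilon>)"

definition strongly_local_form ::
  "'a::topological_space measure \<Rightarrow> (('a \<Rightarrow> real) \<Rightarrow> ('a \<Rightarrow> real) \<Rightarrow> real) \<Rightarrow>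
     ('a \<Rightarrow> real) set \<Rightarrow> bool" where
  "strongly_local_form M E F \<longleftrightarrow>
     (\<forall>u\<in>F. \<forall>v\<in>F.
        compact (ae_support M u) \<longrightarrow> compact (ae_support M v) \<longrightarrow>
        (\<exists>U c. open U \<and> ae_support M u \<subseteq> U \<and> (AE x in M. x \<in> U \<longrightarrow> v x = c)) \<longrightarrow>
        E u v = 0)"


text \<open>Only the diagonal \<open>\<Gamma>(u,u)\<close>, which is a nonnegative measure, is needed.
  For bounded \<open>u\<close> it is the Radon measure given by
  \<open>\<integral>\<phi> d\<Gamma>(u,u) = (\<E>(\<phi>u,u) + \<E>(\<phi>u,u) - \<E>(\<phi>,u\<^sup>2)) / 2\<close> for \<open>\<phi> \<in> F \<inter> C\<^sub>c\<close>; for a general \<open>u \<in> F\<close> it is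
  the increasing limit of the energy measures of the truncations of \<open>u\<close>.\<close>

definition energy_measure_bounded ::
  "(('a::topological_space \<Rightarrow> real) \<Rightarrow> ('a \<Rightarrow> real) \<Rightarrow> real) \<Rightarrow> ('a \<Rightarrow> real) set \<Rightarrow>
     ('a \<Rightarrow> real) \<Rightarrow> 'a measure" where
  "energy_measure_bounded E F u =
     (THE \<nu>. radon_measure \<nu> \<and>
        (\<forall>\<phi>\<in>F \<inter> Cc. (\<integral>x. \<phi> x \<partial>\<nu>) =
           (E (\<lambda>x. \<phi> x * u x) u + E (\<lambda>x. \<phi> x * u x) u - E \<phi> (\<lambda>x. u x * u x)) / 2))"

definition truncate_at :: "nat \<Rightarrow> ('a \<Rightarrow> real) \<Rightarrow> 'a \<Rightarrow> real" where
  "truncate_at n u x = max (- real n) (min (real n) (u x))"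

definition energy_measure ::
  "(('a::topological_space \<Rightarrow> real) \<Rightarrow> ('a \<Rightarrow> real) \<Rightarrow> real) \<Rightarrow> ('a \<Rightarrow> real) set \<Rightarrow>
     ('a \<Rightarrow> real) \<Rightarrow> 'a measure" where
  "energy_measure E F u =
     measure_of UNIV (sets borel)
       (\<lambda>A. SUP n. emeasure (energy_measure_bounded E F (truncate_at n u)) A)"


text \<open>The supremum defining the intrinsic metric may a priori be infinite, so it is taken in
  \<^typ>\<open>ereal\<close>; strict locality includes its finiteness.\<close>

definition intrinsic_edist ::
  "'a::topological_space measure \<Rightarrow> (('a \<Rightarrow> real) \<Rightarrow> ('a \<Rightarrow> real) \<Rightarrow> real) \<Rightarrow>
     ('a \<Rightarrow> real) set \<Rightarrow> 'a \<Rightarrow> 'a \<Rightarrow> ereal" where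
  "intrinsic_edist M E F x y =
     (SUP u\<in>{u \<in> F \<inter> C0. \<forall>A\<in>sets borel. emeasure (energy_measure E F u) A \<le> emeasure M A}.
        ereal (u x - u y))"

definition intrinsic_dist ::
  "'a::topological_space measure \<Rightarrow> (('a \<Rightarrow> real) \<Rightarrow> ('a \<Rightarrow> real) \<Rightarrow> real) \<Rightarrow>
     ('a \<Rightarrow> real) set \<Rightarrow> 'a \<Rightarrow> 'a \<Rightarrow> real" where
  "intrinsic_dist M E F x y = real_of_ereal (intrinsic_edist M E F x y)"

definition strictly_local_form ::
  "'a::topological_space measure \<Rightarrow> (('a \<Rightarrow> real) \<Rightarrow> ('a \<Rightarrow> real) \<Rightarrow> real) \<Rightarrow>
     ('a \<Rightarrow> real) set \<Rightarrow> bool" where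
  "strictly_local_form M E F \<longleftrightarrow>
     (\<forall>x y. \<bar>intrinsic_edist M E F x y\<bar> \<noteq> \<infinity>) \<and>
     Metric_space UNIV (intrinsic_dist M E F) \<and>
     Metric_space.mtopology UNIV (intrinsic_dist M E F) = euclidean"

abbreviation dball :: "('a \<Rightarrow> 'a \<Rightarrow> real) \<Rightarrow> 'a \<Rightarrow> real \<Rightarrow> 'a set" where
  "dball d x r \<equiv> Metric_space.mball UNIV d x r"

definition volume_doubling :: "'a measure \<Rightarrow> ('a \<Rightarrow> 'a \<Rightarrow> real) \<Rightarrow> bool" where
  "volume_doubling M d \<longleftrightarrow>
     (\<exists>C>0. \<forall>x. \<forall>r>0.
        emeasure M (dball d x (2 * r)) \<le> ennreal C * emeasure M (dball d x r))"

definition mean_on :: "'a measure \<Rightarrow> 'a set \<Rightarrow> ('a \<Rightarrow> real) \<Rightarrow> real" where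
  "mean_on M B u = (1 / measure M B) * (\<integral>x\<in>B. u x \<partial>M)"

definition poincare_inequality_2 ::
  "'a::topological_space measure \<Rightarrow> (('a \<Rightarrow> real) \<Rightarrow> ('a \<Rightarrow> real) \<Rightarrow> real) \<Rightarrow>
     ('a \<Rightarrow> real) set \<Rightarrow> ('a \<Rightarrow> 'a \<Rightarrow> real) \<Rightarrow> bool" where
  "poincare_inequality_2 M E F d \<longleftrightarrow>
     (\<exists>C>0. \<exists>\<Lambda>\<ge>1. \<forall>x. \<forall>r>0. \<forall>u\<in>F.
        mean_on M (dball d x r) (\<lambda>y. \<bar>u y - mean_on M (dball d x r) u\<bar>) \<le>
        C * r * sqrt (measure (energy_measure E F u) (dball d x (\<Lambda> * r)) /
                      measure M (dball d x (\<Lambda> * r))))"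


text \<open>The semigroup associated with the form \<open>(E, F)\<close>: the symmetric strongly continuous
  contraction semigroup \<open>P\<^sub>t = e\<^bsup>tL\<^esup>\<close> on \<open>L\<^sup>2\<close> whose generator \<open>L\<close> satisfies \<open>dom L \<subseteq> F\<close> and
  \<open>\<E>(u,v) = -\<langle>Lu,v\<rangle>\<close> for \<open>u \<in> dom L\<close>, \<open>v \<in> F\<close>. Since both \<open>L\<close> and the operator of the closed form
  are self-adjoint, this determines the semigroup.\<close>

definition l2_semigroup ::
  "'a measure \<Rightarrow> (real \<Rightarrow> ('a \<Rightarrow> real) \<Rightarrow> ('a \<Rightarrow> real)) \<Rightarrow> bool" where
  "l2_semigroup M P \<longleftrightarrow>
     (\<forall>t>0. \<forall>f\<in>Lp M 2. P t f \<in> Lp M 2 \<and> l2_norm M (P t f) \<le> l2_norm M f) \<and>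
     (\<forall>t>0. \<forall>f\<in>Lp M 2. \<forall>g\<in>Lp M 2. \<forall>a b.
        AE x in M. P t (\<lambda>y. a * f y + b * g y) x = a * P t f x + b * P t g x) \<and>
     (\<forall>t>0. \<forall>f\<in>Lp M 2. \<forall>g\<in>Lp M 2. l2_inner M (P t f) g = l2_inner M f (P t g)) \<and>
     (\<forall>s>0. \<forall>t>0. \<forall>f\<in>Lp M 2. AE x in M. P (s + t) f x = P s (P t f) x) \<and>
     (\<forall>f\<in>Lp M 2. ((\<lambda>t. l2_norm M (\<lambda>x. P t f x - f x)) \<longlongrightarrow> 0) (at_right 0))"

definition l2_generator ::
  "'a measure \<Rightarrow> (real \<Rightarrow> ('a \<Rightarrow> real) \<Rightarrow> ('a \<Rightarrow> real)) \<Rightarrow> (('a \<Rightarrow> real) \<times> ('a \<Rightarrow> real)) set" where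
  "l2_generator M P =
     {(u, w). u \<in> Lp M 2 \<and> w \<in> Lp M 2 \<and>
        ((\<lambda>t. l2_norm M (\<lambda>x. (P t u x - u x) / t - w x)) \<longlongrightarrow> 0) (at_right 0)}"

definition associated_semigroup ::
  "'a measure \<Rightarrow> (('a \<Rightarrow> real) \<Rightarrow> ('a \<Rightarrow> real) \<Rightarrow> real) \<Rightarrow> ('a \<Rightarrow> real) set \<Rightarrow>
     (real \<Rightarrow> ('a \<Rightarrow> real) \<Rightarrow> ('a \<Rightarrow> real)) \<Rightarrow> bool" where
  "associated_semigroup M E F P \<longleftrightarrow>
     l2_semigroup M P \<and>
     (\<forall>(u, w)\<in>l2_generator M P. u \<in> F \<and> (\<forall>v\<in>F. E u v = - l2_inner M w v))"

text \<open>For each \<open>t\<close> the heat kernel is determined up to null sets of \<open>M \<otimes> M\<close>, which the Besov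
  seminorm does not see.\<close>

definition heat_kernel ::
  "'a measure \<Rightarrow> (('a \<Rightarrow> real) \<Rightarrow> ('a \<Rightarrow> real) \<Rightarrow> real) \<Rightarrow> ('a \<Rightarrow> real) set \<Rightarrow>
     (real \<Rightarrow> 'a \<Rightarrow> 'a \<Rightarrow> real) \<Rightarrow> bool" where
  "heat_kernel M E F h \<longleftrightarrow>
     (\<exists>P. associated_semigroup M E F P \<and>
        (\<forall>t>0.
           (\<lambda>(x, y). h t x y) \<in> borel_measurable (M \<Otimes>\<^sub>M M) \<and>
           (\<forall>x y. 0 \<le> h t x y) \<and>
           (\<forall>f\<in>Lp M 2. AE x in M.
              integrable M (\<lambda>y. h t x y * f y) \<and> P t f x = (\<integral>y. h t x y * f y \<partial>M))))"


text \<open>Meaningful for exponents \<open>a > 0\<close> only.\<close>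

definition ennreal_powr :: "ennreal \<Rightarrow> real \<Rightarrow> ennreal" where
  "ennreal_powr x a = (if x = \<infinity> then \<infinity> else ennreal (enn2real x powr a))"

definition besov_seminorm ::
  "'a measure \<Rightarrow> (real \<Rightarrow> 'a \<Rightarrow> 'a \<Rightarrow> real) \<Rightarrow> real \<Rightarrow> real \<Rightarrow> ('a \<Rightarrow> real) \<Rightarrow> ennreal" where
  "besov_seminorm M h p \<alpha> f =
     (SUP t\<in>{0<..}. ennreal (t powr (- \<alpha>)) *
        ennreal_powr (\<integral>\<^sup>+x. (\<integral>\<^sup>+y. ennreal (h t x y * \<bar>f x - f y\<bar> powr p) \<partial>M) \<partial>M) (1 / p))"

definition besov_space ::
  "'a measure \<Rightarrow> (real \<Rightarrow> 'a \<Rightarrow> 'a \<Rightarrow> real) \<Rightarrow> real \<Rightarrow> real \<Rightarrow> ('a \<Rightarrow> real) set" where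
  "besov_space M h p \<alpha> = {f \<in> Lp M p. besov_seminorm M h p \<alpha> f < \<infinity>}"

end

theory Submission
  imports Defs
begin

text \<open>Let \<open>m t = \<mu>{\<bar>f\<bar> \<ge> t}\<close> and choose \<open>r\<close> with \<open>C\<^sub>1 r\<^sup>Q = 2 m t\<close>, so that for every \<open>x\<close> at least
  half of the mass of \<open>B(x,r)\<close> lies in \<open>{\<bar>f\<bar> < t}\<close>. If \<open>\<bar>f x\<bar> \<ge> 2t\<close>, then \<open>\<bar>f x - f y\<bar> \<ge> t\<close> on that half,
  and integrating gives \<open>m (2t) \<le> K t powr (-p) * (m t) powr \<theta>\<close> with \<open>\<theta> = p\<delta>/Q < 1\<close>. In terms of
  \<open>w t = t powr q * m t\<close> this is the scale-invariant bound \<open>w (2t) \<le> A * (w t) powr \<theta>\<close>, which bounds \<open>w\<close>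
  once it is known to be locally bounded; this is where \<open>f \<in> L\<^sup>p\<close> enters. The isoperimetric
  inequality is the same ball argument applied to a single set.\<close>

section \<open>Powers in the extended nonnegative reals\<close>

lemma ennreal_powr_ennreal [simp]: "0 \<le> x \<Longrightarrow> ennreal_powr (ennreal x) a = ennreal (x powr a)"
  by (simp add: ennreal_powr_def)

text \<open>Turns a bound on one term of the Besov-type supremum into a bound on the integral inside
  it. A finite right side and \<open>0 < c\<close> rule out \<open>I = \<infinity>\<close>.\<close>

lemma le_of_ennreal_powr_le:
  assumes p: "0 < p" and c: "0 < c" and n: "0 \<le> n"
    and le: "ennreal c * ennreal_powr I (1 / p) \<le> ennreal n"
  shows "I \<le> ennreal ((n / c) powr p)"
proof (cases "I = \<infinity>")
  case True
  with le c show ?thesis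
    by (simp add: ennreal_powr_def ennreal_mult_top top_unique)
next
  case False
  then obtain i where i: "I = ennreal i" "0 \<le> i"
    by (cases I) auto
  have "c * i powr (1 / p) \<le> n"
    using le c n i by (simp add: ennreal_mult[symmetric])
  then have "i powr (1 / p) \<le> n / c"
    using c by (simp add: field_simps)
  then have "(i powr (1 / p)) powr p \<le> (n / c) powr p"
    using p by (intro powr_mono2) auto
  then show ?thesis
    using i p by (simp add: powr_powr ennreal_leI)
qed

section \<open>Weak-type bound from an iterated inequality\<close>

text \<open>The exponent satisfies \<open>q * \<theta> = q - p\<close>, so the powers of
  \<open>t\<close> in \<open>step\<close> are absorbed by \<open>w\<close>. For the supremum
  \<open>W\<close> of \<open>w\<close> this gives
  \<open>W \<le> 2 powr q * K * W powr \<theta>\<close>, which can be solved for a finite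
  \<open>W\<close> since \<open>\<theta> < 1\<close>. \<open>L\<close> ensures the finiteness and
  does not enter the final bound.\<close>

lemma weak_type_iteration:
  fixes m :: "real \<Rightarrow> real"
  assumes \<theta>: "0 \<le> \<theta>" "\<theta> < 1" and p: "0 < p" and q: "q = p / (1 - \<theta>)" and K: "0 \<le> K"
    and nonneg: "\<And>t. 0 \<le> m t"
    and bound: "\<And>t. 0 < t \<Longrightarrow> m t * t powr p \<le> L"
    and step: "\<And>t. 0 < t \<Longrightarrow> m (2 * t) \<le> K * t powr (- p) * m t powr \<theta>"
    and T: "0 < T"
  shows "T powr q * m T \<le> (2 powr q * K) powr (1 / (1 - \<theta>))"
proof -
  define w where "w t = t powr q * m t" for t
  \<comment> \<open>The range stops at \<open>T\<close> because \<open>bound\<close> controls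
    \<open>w t\<close> only by \<open>t powr (q - p) * L\<close>, which may grow with
    \<open>t\<close>. Halving a point of \<open>{0<..T}\<close> stays inside.\<close>
  define W where "W = (SUP t\<in>{0<..T}. w t)"
  have q\<theta>: "q * \<theta> = q - p" and qp: "p \<le> q"
  proof -
    show "q * \<theta> = q - p"
      using \<theta> q by (simp add: field_simps)
    moreover have "0 \<le> q * \<theta>"
      using \<theta> p q by simp
    ultimately show "p \<le> q" by simp
  qed
  have L: "0 \<le> L"
    using bound[OF T] nonneg[of T] by (meson mult_nonneg_nonneg order_trans powr_ge_zero)
  have w_nonneg: "0 \<le> w t" for t
    by (simp add: w_def nonneg)
  have w_bound: "w t \<le> T powr (q - p) * L" if "t \<in> {0<..T}" for t
  proof -
    have "w t = t powr (q - p) * (m t * t powr p)"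
      using that by (simp add: w_def powr_diff)
    also have "\<dots> \<le> T powr (q - p) * L"
      using that qp L nonneg by (intro mult_mono bound powr_mono2) auto
    finally show ?thesis .
  qed
  then have bdd: "bdd_above (w ` {0<..T})"
    by (intro bdd_aboveI2)
  have w_le: "w t \<le> W" if "t \<in> {0<..T}" for t
    unfolding W_def using that bdd by (rule cSUP_upper)
  have "w t \<le> 2 powr q * K * W powr \<theta>" if t: "t \<in> {0<..T}" for t
  proof -
    define s where "s = t / 2"
    have s: "0 < s" "t = 2 * s" "s \<in> {0<..T}"
      using t by (auto simp: s_def)
    have "w t \<le> 2 powr q * s powr q * (K * s powr (- p) * m s powr \<theta>)"
      using step[OF s(1)] s by (simp add: w_def powr_mult mult_left_mono)
    also have "\<dots> = 2 powr q * K * (s powr (q * \<theta>) * m s powr \<theta>)"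
      by (simp add: q\<theta> powr_diff powr_minus_divide)
    also have "s powr (q * \<theta>) * m s powr \<theta> = w s powr \<theta>"
      using nonneg s by (simp add: w_def powr_mult powr_powr)
    also have "2 powr q * K * w s powr \<theta> \<le> 2 powr q * K * W powr \<theta>"
      using w_le[OF s(3)] w_nonneg \<theta> K by (intro mult_left_mono powr_mono2) auto
    finally show ?thesis .
  qed
  then have W_le: "W \<le> 2 powr q * K * W powr \<theta>"
    unfolding W_def using T by (intro cSUP_least) (auto simp: W_def)
  have "w T \<le> W"
    using w_le T by simp
  \<comment> \<open>Dividing by \<open>W powr \<theta>\<close> requires \<open>W > 0\<close>;
    otherwise the nonnegative right side suffices.\<close>
  also have "W \<le> (2 powr q * K) powr (1 / (1 - \<theta>))"
  proof (cases "W \<le> 0")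
    case True
    then show ?thesis by (rule order_trans) simp
  next
    case False
    then have "W powr (1 - \<theta>) \<le> 2 powr q * K"
      using W_le by (simp add: powr_diff field_simps)
    then have "(W powr (1 - \<theta>)) powr (1 / (1 - \<theta>)) \<le> (2 powr q * K) powr (1 / (1 - \<theta>))"
      using \<theta> by (intro powr_mono2) auto
    then show ?thesis
      using False \<theta> by (simp add: powr_powr)
  qed
  finally show ?thesis
    by (simp add: w_def)
qed

section \<open>Joint measurability of the distance and sigma-finiteness\<close>

text \<open>The product sigma-algebra calls for countably many rectangles. Separability provides
  them: \<open>d x y < a\<close> holds iff some centre \<open>c\<close> in a countable dense set and
  some rational \<open>b\<close> satisfy \<open>d c x < b\<close> and
  \<open>d c y < a - b\<close>.\<close>

lemma Metric_space_borel_measurable_pair: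
  fixes M :: "'a measure"
  assumes "Metric_space UNIV d" and space: "space M = UNIV"
    and sep: "separable_space (Metric_space.mtopology UNIV d)"
    and balls: "\<And>x r. Metric_space.mball UNIV d x r \<in> sets M"
  shows "(\<lambda>z. d (fst z) (snd z)) \<in> borel_measurable (M \<Otimes>\<^sub>M M)"
proof -
  interpret Metric_space UNIV d by fact
  obtain D where D: "countable D" "mtopology closure_of D = UNIV"
    using sep by (auto simp: separable_space_def)
  have dense: "\<exists>z\<in>D. d x z < e" if "0 < e" for x e
  proof -
    have "x \<in> mtopology closure_of D" by (simp add: D)
    then show ?thesis
      using that by (fastforce simp: metric_closure_of)
  qed
  have "{z. d (fst z) (snd z) < a} = (\<Union>c\<in>D. \<Union>b\<in>\<rat>. mball c b \<times> mball c (a - b))"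
    (is "?L = ?R") for a
  proof (intro set_eqI iffI)
    fix z assume z: "z \<in> ?L"
    \<comment> \<open>With a third of the slack, \<open>d c (snd z)\<close> stays below
      \<open>e + (a - 3 * e)\<close>, hence below \<open>a - b\<close> as
      \<open>b < e\<close>.\<close>
    define e where "e = (a - d (fst z) (snd z)) / 3"
    have e: "0 < e" using z by (simp add: e_def)
    obtain c where c: "c \<in> D" "d (fst z) c < e" using dense[OF e] by blast
    obtain b where b: "b \<in> \<rat>" "d (fst z) c < b" "b < e"
      using Rats_dense_in_real[OF c(2)] by blast
    have "d c (snd z) \<le> d c (fst z) + d (fst z) (snd z)" by (intro triangle) auto
    also have "\<dots> < a - b"
    proof -
      have "a = 3 * e + d (fst z) (snd z)" by (simp add: e_def diff_divide_distrib)
      then show ?thesis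
        using c(2) b(2,3) e commute[of c "fst z"] by linarith
    qed
    finally have "z \<in> mball c b \<times> mball c (a - b)"
      using b commute[of c "fst z"] by (cases z) (auto simp: in_mball)
    then show "z \<in> ?R" using c b by blast
  next
    fix z assume "z \<in> ?R"
    then obtain c b where "d c (fst z) < b" "d c (snd z) < a - b" by auto
    then show "z \<in> ?L"
      using triangle[of "fst z" c "snd z"] commute[of c "fst z"] by simp
  qed
  moreover have "(\<Union>c\<in>D. \<Union>b\<in>\<rat>. mball c b \<times> mball c (a - b)) \<in> sets (M \<Otimes>\<^sub>M M)" for a
    using D countable_rat balls by (intro sets.countable_UN'') (auto intro: pair_measureI)
  ultimately show ?thesis
    by (simp add: borel_measurable_iff_less space_pair_measure space)
qed

lemma doubling_ball_finite:
  assumes "volume_doubling M d" and r: "0 < r" and fin: "emeasure M (dball d x r) < \<infinity>"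
  shows "emeasure M (dball d x (2 ^ n * r)) < \<infinity>"
proof -
  obtain C where "\<And>r. 0 < r \<Longrightarrow>
      emeasure M (dball d x (2 * r)) \<le> ennreal C * emeasure M (dball d x r)"
    using assms(1) by (auto simp: volume_doubling_def)
  then show ?thesis
  proof (induction n)
    case (Suc n)
    have "emeasure M (dball d x (2 * (2 ^ n * r))) \<le> ennreal C * emeasure M (dball d x (2 ^ n * r))"
      using Suc.prems r by simp
    also have "\<dots> < \<infinity>"
      using Suc by (simp add: ennreal_mult_less_top)
    finally show ?case by (simp add: mult.assoc)
  qed (use fin in simp)
qed

text \<open>Local compactness puts a small ball around each point into a compact set of finite
  measure. Doubling then makes all balls finite, and those of integer radius about one point cover
  the space. Tonelli's theorem on the product rests on this.\<close>

lemma sigma_finite_measure_doubling: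
  fixes M :: "'a::topological_space measure"
  assumes lc: "locally_compact_space (euclidean :: 'a topology)" and M: "radon_measure M"
    and d: "Metric_space UNIV d" and top: "Metric_space.mtopology UNIV d = euclidean"
    and dbl: "volume_doubling M d"
  shows "sigma_finite_measure M"
proof -
  interpret Metric_space UNIV d by fact
  have sets_M: "sets M = sets borel" and compact_finite: "\<And>K. compact K \<Longrightarrow> emeasure M K < \<infinity>"
    using M by (auto simp: radon_measure_def)
  have ball_sets: "dball d x r \<in> sets M" for x r
    using openin_mball[of x r] by (simp add: top sets_M)
  have fin: "emeasure M (dball d x (real n)) < \<infinity>" for x n
  proof -
    obtain U K where U: "open U" "compact K" "x \<in> U" "U \<subseteq> K"
      using lc unfolding locally_compact_space_def by simp blast
    obtain r where r: "0 < r" "dball d x r \<subseteq> U"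
      using U openin_mtopology[of U] by (auto simp: top)
    \<comment> \<open>\<open>K\<close> has to be measurable. The type class gives no Hausdorff
      property, so closedness comes from the metric topology.\<close>
    have "closed K"
      using compactin_imp_closedin[OF Hausdorff_space_mtopology, of K] U(2) by (simp add: top)
    then have "emeasure M (dball d x r) \<le> emeasure M K"
      using r U sets_M by (intro emeasure_mono) auto
    then have r_fin: "emeasure M (dball d x r) < \<infinity>"
      using compact_finite[OF U(2)] by (rule le_less_trans)
    obtain k where k: "real n / r < 2 ^ k"
      using real_arch_pow[of 2] by auto
    have "emeasure M (dball d x (real n)) \<le> emeasure M (dball d x (2 ^ k * r))"
      using k r by (intro emeasure_mono mball_subset_concentric ball_sets) (simp add: field_simps)
    also have "\<dots> < \<infinity>"
      using dbl r(1) r_fin by (rule doubling_ball_finite)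
    finally show ?thesis .
  qed
  have "\<exists>n. y \<in> dball d x (real n)" for x y
    using reals_Archimedean2[of "d x y"] by auto
  then have "(\<Union>n. dball d x (real n)) = space M" for x
    using sets_eq_imp_space_eq[OF sets_M] by auto
  \<comment> \<open>\<open>undefined\<close> is merely some point of the type, used as the common
    centre.\<close>
  then show ?thesis
    using fin[THEN less_imp_neq] ball_sets
    by (intro sigma_finite_measure.intro exI[of _ "range (\<lambda>n. dball d undefined (real n))"]) auto
qed

section \<open>The ball argument under volume growth\<close>

text \<open>What the estimates take from the Dirichlet space: sigma-finiteness for Tonelli, joint
  measurability for sets of near pairs, and a lower bound on ball volumes.\<close>

locale volume_growth = sigma_finite_measure M for M :: "'a measure" +
  fixes d :: "'a \<Rightarrow> 'a \<Rightarrow> real" and Q c :: real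
  assumes space_M: "space M = UNIV"
    and dist_measurable [measurable]: "(\<lambda>z. d (fst z) (snd z)) \<in> borel_measurable (M \<Otimes>\<^sub>M M)"
    and Q_pos: "0 < Q" and c_pos: "0 < c"
    and growth: "0 \<le> r \<Longrightarrow> ennreal (c * r powr Q) \<le> emeasure M {y. d x y < r}"
begin

lemma dist_less_sets: "{(x, y). d x y < r} \<in> sets (M \<Otimes>\<^sub>M M)"
proof -
  have "{z \<in> space (M \<Otimes>\<^sub>M M). d (fst z) (snd z) < r} \<in> sets (M \<Otimes>\<^sub>M M)"
    by measurable
  then show ?thesis
    by (simp add: space_pair_measure space_M case_prod_unfold)
qed

lemma dist_le_sets: "{(x, y). d x y \<le> r} \<in> sets (M \<Otimes>\<^sub>M M)"
proof -
  have "{z \<in> space (M \<Otimes>\<^sub>M M). d (fst z) (snd z) \<le> r} \<in> sets (M \<Otimes>\<^sub>M M)"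
    by measurable
  then show ?thesis
    by (simp add: space_pair_measure space_M case_prod_unfold)
qed

lemma Compl_sets: "A \<in> sets M \<Longrightarrow> - A \<in> sets M"
  using sets.compl_sets[of A M] by (simp add: space_M Compl_eq_Diff_UNIV)

text \<open>\<open>T\<close> removes at most half of the mass \<open>c * r powr Q\<close> guaranteed
  to each ball, so every \<open>x \<in> S\<close> keeps the other half outside \<open>T\<close>;
  integrate over \<open>S\<close>. Applied with both sets equal for the isoperimetric inequality and
  with two superlevel sets for the Sobolev one.\<close>

lemma emeasure_near_pairs_ge:
  assumes S [measurable]: "S \<in> sets M" and T [measurable]: "T \<in> sets M" and r: "0 \<le> r"
    and T_le: "emeasure M T \<le> ennreal (c * r powr Q / 2)"
  shows "ennreal (c * r powr Q / 2) * emeasure M S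
      \<le> emeasure (M \<Otimes>\<^sub>M M) {(x, y). x \<in> S \<and> y \<in> - T \<and> d x y < r}"
proof -
  let ?G = "{(x, y). x \<in> S \<and> y \<in> - T \<and> d x y < r}"
  have "?G = (S \<times> - T) \<inter> {(x, y). d x y < r}"
    by auto
  then have G: "?G \<in> sets (M \<Otimes>\<^sub>M M)"
    using dist_less_sets Compl_sets[OF T] S by auto
  have fibre: "ennreal (c * r powr Q / 2) \<le> emeasure M (Pair x -` ?G)" if x: "x \<in> S" for x
  proof -
    have B: "{y. d x y < r} \<in> sets M"
      using sets_Pair1[OF dist_less_sets, of x r] by (simp add: vimage_def)
    have "ennreal (c * r powr Q / 2) + ennreal (c * r powr Q / 2) = ennreal (c * r powr Q)"
      using c_pos by (simp flip: ennreal_plus)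
    also have "\<dots> \<le> emeasure M {y. d x y < r}"
      by (rule growth[OF r])
    also have "\<dots> \<le> emeasure M (({y. d x y < r} - T) \<union> T)"
      using B by (intro emeasure_mono) auto
    also have "\<dots> \<le> emeasure M ({y. d x y < r} - T) + emeasure M T"
      using B by (intro emeasure_subadditive) auto
    also have "\<dots> \<le> emeasure M ({y. d x y < r} - T) + ennreal (c * r powr Q / 2)"
      using T_le by (rule add_left_mono)
    \<comment> \<open>The half mass is finite, so it cancels.\<close>
    finally have "ennreal (c * r powr Q / 2) \<le> emeasure M ({y. d x y < r} - T)"
      by (simp add: ennreal_add_left_cancel_le add.commute)
    also have "{y. d x y < r} - T = Pair x -` ?G"
      using x by auto
    finally show ?thesis .
  qed
  have "ennreal (c * r powr Q / 2) * emeasure M S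
      = (\<integral>\<^sup>+x. ennreal (c * r powr Q / 2) * indicator S x \<partial>M)"
    by (simp add: nn_integral_cmult_indicator)
  also have "\<dots> \<le> (\<integral>\<^sup>+x. emeasure M (Pair x -` ?G) \<partial>M)"
    using fibre by (intro nn_integral_mono) (auto simp: indicator_def)
  also have "\<dots> = emeasure (M \<Otimes>\<^sub>M M) ?G"
    using G by (simp add: emeasure_pair_measure_alt)
  finally show ?thesis .
qed

text \<open>At this radius a set of mass \<open>a\<close> takes up at most half of the guaranteed
  mass of any ball. The closed form of \<open>r\<close> serves the exponent arithmetic
  later.\<close>

lemma ex_radius:
  assumes "0 < a"
  obtains r where "0 < r" "c * r powr Q = 2 * a" "r = (2 * a / c) powr (1 / Q)"
  using assms Q_pos c_pos
  by (intro that[of "(2 * a / c) powr (1 / Q)"]) (auto simp: powr_powr)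

section \<open>Isoperimetric inequality\<close>

text \<open>One radius in the supremum suffices. When \<open>c * r powr Q = 2 * a\<close>, the near
  pairs have measure at least \<open>a * a\<close>, and \<open>r powr (\<delta> + Q)\<close> is a
  constant times \<open>a powr (1 + \<delta> / Q)\<close>, so the quotient has the power
  \<open>1 - \<delta> / Q\<close> of \<open>a\<close>.\<close>

lemma isoperimetric:
  assumes \<delta>: "0 < \<delta>" "\<delta> < Q" and A: "A \<in> sets M" and fin: "emeasure M A < \<infinity>"
  shows "ennreal_powr (emeasure M A) ((Q - \<delta>) / Q)
    \<le> ennreal ((2 / c) powr (1 + \<delta> / Q)) *
      (SUP r\<in>{0<..}. ennreal (1 / r powr (\<delta> + Q)) *
         emeasure (M \<Otimes>\<^sub>M M) {(x, y). x \<in> A \<and> y \<in> - A \<and> d x y \<le> r})"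
    (is "_ \<le> _ * ?N")
proof -
  define a where "a = measure M A"
  have a: "emeasure M A = ennreal a" "0 \<le> a"
    using fin by (auto simp: a_def emeasure_eq_ennreal_measure)
  show ?thesis
  \<comment> \<open>A positive radius needs \<open>a > 0\<close>; for \<open>a = 0\<close> the left
    side vanishes since \<open>0 powr x = 0\<close>.\<close>
  proof (cases "a = 0")
    case False
    then obtain r where r: "0 < r" "c * r powr Q = 2 * a" "r = (2 * a / c) powr (1 / Q)"
      using ex_radius[of a] a by auto
    have G: "{(x, y). x \<in> A \<and> y \<in> - A \<and> d x y \<le> r} \<in> sets (M \<Otimes>\<^sub>M M)"
    proof -
      have "{(x, y). x \<in> A \<and> y \<in> - A \<and> d x y \<le> r} = (A \<times> - A) \<inter> {(x, y). d x y \<le> r}"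
        by auto
      then show ?thesis
        using dist_le_sets Compl_sets[OF A] A by auto
    qed
    have "ennreal (a * a) = ennreal (c * r powr Q / 2) * emeasure M A"
      using r a by (simp add: ennreal_mult)
    also have "\<dots> \<le> emeasure (M \<Otimes>\<^sub>M M) {(x, y). x \<in> A \<and> y \<in> - A \<and> d x y < r}"
      using A r a by (intro emeasure_near_pairs_ge) auto
    also have "\<dots> \<le> emeasure (M \<Otimes>\<^sub>M M) {(x, y). x \<in> A \<and> y \<in> - A \<and> d x y \<le> r}"
      using G by (intro emeasure_mono) auto
    finally have "ennreal (1 / r powr (\<delta> + Q)) * ennreal (a * a) \<le> ?N"
      using r by (intro SUP_upper2[of r] mult_left_mono) auto
    then have N: "ennreal (a * a / r powr (\<delta> + Q)) \<le> ?N"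
      using a by (simp flip: ennreal_mult)
    have rp: "r powr (\<delta> + Q) = (2 * a / c) powr (\<delta> / Q + 1)"
      using r(3) Q_pos by (simp add: powr_powr add_divide_distrib)
    have "a powr ((Q - \<delta>) / Q) = (2 / c) powr (1 + \<delta> / Q) * (a * a / r powr (\<delta> + Q))"
    proof -
      have "(2 * a / c) powr (\<delta> / Q + 1) = (2 / c) powr (1 + \<delta> / Q) * a powr (1 + \<delta> / Q)"
        using a c_pos powr_mult[of "2 / c" a] by (simp add: add.commute)
      moreover have "a powr ((Q - \<delta>) / Q) * a powr (1 + \<delta> / Q) = a * a"
        using a False Q_pos
        by (simp flip: powr_add add: diff_divide_distrib powr_numeral power2_eq_square)
      ultimately have "a powr ((Q - \<delta>) / Q) * r powr (\<delta> + Q) = (2 / c) powr (1 + \<delta> / Q) * (a * a)"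
        unfolding rp by simp
      then show ?thesis
        using r(1) by (simp add: field_simps)
    qed
    then have "ennreal_powr (emeasure M A) ((Q - \<delta>) / Q)
        = ennreal ((2 / c) powr (1 + \<delta> / Q)) * ennreal (a * a / r powr (\<delta> + Q))"
      using a by (simp flip: ennreal_mult)
    also have "\<dots> \<le> ennreal ((2 / c) powr (1 + \<delta> / Q)) * ?N"
      using N by (rule mult_left_mono) simp
    finally show ?thesis .
  qed (simp add: a ennreal_powr_def)
qed

section \<open>Weak-type Sobolev inequality\<close>

text \<open>A Chebyshev inequality for differences: \<open>\<bar>f x\<bar> \<ge> 2 * t\<close> and
  \<open>\<bar>f y\<bar> < t\<close> force \<open>\<bar>f x - f y\<bar> \<ge> t\<close>, and the
  ball argument bounds the measure of such near pairs from below.\<close>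

lemma superlevel_le:
  assumes f [measurable]: "f \<in> borel_measurable M"
    and p: "0 < p" and t: "0 < t" and r: "0 \<le> r"
    and small: "emeasure M {x. t \<le> \<bar>f x\<bar>} \<le> ennreal (c * r powr Q / 2)"
  shows "ennreal (t powr p * (c * r powr Q / 2)) * emeasure M {x. 2 * t \<le> \<bar>f x\<bar>}
    \<le> (\<integral>\<^sup>+z\<in>{(x, y). d x y < r}. ennreal (\<bar>f (fst z) - f (snd z)\<bar> powr p) \<partial>(M \<Otimes>\<^sub>M M))"
proof -
  have sets: "{x. s \<le> \<bar>f x\<bar>} \<in> sets M" for s
  proof -
    have "{x \<in> space M. s \<le> \<bar>f x\<bar>} \<in> sets M" by measurable
    then show ?thesis by (simp add: space_M)
  qed
  let ?S = "{x. 2 * t \<le> \<bar>f x\<bar>}" and ?T = "{x. t \<le> \<bar>f x\<bar>}"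
  let ?G = "{(x, y). x \<in> ?S \<and> y \<in> - ?T \<and> d x y < r}"
  have G: "?G \<in> sets (M \<Otimes>\<^sub>M M)"
  proof -
    have "?G = (?S \<times> - ?T) \<inter> {(x, y). d x y < r}" by auto
    then show ?thesis
      by (simp only:) (intro sets.Int pair_measureI Compl_sets sets dist_less_sets)
  qed
  have "ennreal (t powr p * (c * r powr Q / 2)) * emeasure M ?S
      = ennreal (t powr p) * (ennreal (c * r powr Q / 2) * emeasure M ?S)"
    using c_pos by (subst ennreal_mult) (simp_all add: mult.assoc)
  also have "\<dots> \<le> ennreal (t powr p) * emeasure (M \<Otimes>\<^sub>M M) ?G"
    using r small by (intro mult_left_mono emeasure_near_pairs_ge sets) auto
  also have "\<dots> = (\<integral>\<^sup>+z. ennreal (t powr p) * indicator ?G z \<partial>(M \<Otimes>\<^sub>M M))"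
    using G by (simp add: nn_integral_cmult_indicator)
  also have "\<dots> \<le> (\<integral>\<^sup>+z\<in>{(x, y). d x y < r}.
      ennreal (\<bar>f (fst z) - f (snd z)\<bar> powr p) \<partial>(M \<Otimes>\<^sub>M M))"
  proof (intro nn_integral_mono)
    fix z :: "'a \<times> 'a"
    show "ennreal (t powr p) * indicator ?G z
      \<le> ennreal (\<bar>f (fst z) - f (snd z)\<bar> powr p) * indicator {(x, y). d x y < r} z"
    proof (cases "z \<in> ?G")
      case True
      then have "t \<le> \<bar>f (fst z) - f (snd z)\<bar>" "z \<in> {(x, y). d x y < r}"
        by auto
      then show ?thesis
        using True t p by (auto intro!: ennreal_leI powr_mono2)
    qed simp
  qed
  finally show ?thesis .
qed

text \<open>At the radius with \<open>c * r powr Q = 2 * m t\<close>, the supremum \<open>n\<close>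
  bounds the integral by \<open>n powr p * (2 * m t / c) powr (1 + \<theta>)\<close>, while
  \<open>superlevel_le\<close> bounds it below by \<open>t powr p * m t * m (2 * t)\<close>.
  Cancelling \<open>m t\<close> yields the hypothesis of \<open>weak_type_iteration\<close>.\<close>

lemma weak_sobolev:
  assumes \<delta>: "0 < \<delta>" "\<delta> < Q" and p: "1 \<le> p" "p < Q / \<delta>" and q: "q = p * Q / (Q - p * \<delta>)"
    and f: "f \<in> Lp M p" and s: "0 \<le> s"
  shows "ennreal s * ennreal_powr (emeasure M {x. s \<le> \<bar>f x\<bar>}) (1 / q)
    \<le> ennreal ((2 powr q * (2 / c) powr (1 + p * \<delta> / Q)) powr (1 / p)) *
      (SUP r\<in>{0<..}. ennreal (1 / r powr (\<delta> + Q / p)) *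
         ennreal_powr
           (\<integral>\<^sup>+z\<in>{(x, y). d x y < r}. ennreal (\<bar>f (fst z) - f (snd z)\<bar> powr p) \<partial>(M \<Otimes>\<^sub>M M))
           (1 / p))"
    (is "_ \<le> ennreal (?A powr (1 / p)) * ?N")
\<comment> \<open>For \<open>s = 0\<close> the left side is zero even if the superlevel set has
  infinite measure, as \<open>0 * \<infinity> = 0\<close> in \<open>ennreal\<close>.\<close>
proof (cases "s = 0 \<or> ?N = \<infinity>")
  case True
  then show ?thesis
  proof
    assume "?N = \<infinity>"
    then have "ennreal (?A powr (1 / p)) * ?N = \<infinity>"
      using c_pos by (simp only: ennreal_mult_top infinity_ennreal_def) (simp add: ennreal_eq_0_iff)
    then show ?thesis
      by (simp only: infinity_ennreal_def top_greatest)
  qed simp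
next
  case False
  then obtain n where n: "?N = ennreal n" "0 \<le> n"
    by (cases ?N) auto
  define \<theta> where "\<theta> = p * \<delta> / Q"
  have \<theta>: "0 < \<theta>" "\<theta> < 1"
    using \<delta> p Q_pos by (auto simp: \<theta>_def field_simps)
  have q\<theta>: "q = p / (1 - \<theta>)"
    using q Q_pos by (simp add: \<theta>_def field_simps)
  define m where "m t = measure M {x. t \<le> \<bar>f x\<bar>}" for t
  define L where "L = (\<integral>x. \<bar>f x\<bar> powr p \<partial>M)"
  have f_meas [measurable]: "f \<in> borel_measurable M"
    and f_int: "integrable M (\<lambda>x. \<bar>f x\<bar> powr p)"
    using f by (auto simp: Lp_def)
  have sets: "{x. t \<le> \<bar>f x\<bar>} \<in> sets M" for t
  proof -
    have "{x \<in> space M. t \<le> \<bar>f x\<bar>} \<in> sets M" by measurable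
    then show ?thesis by (simp add: space_M)
  qed
  \<comment> \<open>Markov's inequality makes superlevel sets at positive heights finite and
    supplies the bound \<open>L\<close> for the iteration.\<close>
  have markov: "ennreal (t powr p) * emeasure M {x. t \<le> \<bar>f x\<bar>} \<le> ennreal L" if t: "0 < t" for t
  proof -
    have "ennreal (t powr p) * emeasure M {x. t \<le> \<bar>f x\<bar>}
        = (\<integral>\<^sup>+x. ennreal (t powr p) * indicator {x. t \<le> \<bar>f x\<bar>} x \<partial>M)"
      using sets by (simp add: nn_integral_cmult_indicator)
    also have "\<dots> \<le> (\<integral>\<^sup>+x. ennreal (\<bar>f x\<bar> powr p) \<partial>M)"
      using t p by (intro nn_integral_mono) (auto simp: indicator_def intro!: ennreal_leI powr_mono2)
    also have "\<dots> = ennreal L"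
      unfolding L_def using f_int by (intro nn_integral_eq_integral) auto
    finally show ?thesis .
  qed
  have m: "emeasure M {x. t \<le> \<bar>f x\<bar>} = ennreal (m t)" if t: "0 < t" for t
  proof -
    have "emeasure M {x. t \<le> \<bar>f x\<bar>} \<noteq> \<infinity>"
      using markov[OF t] t by (auto simp: ennreal_mult_top top_unique)
    then show ?thesis
      by (simp add: m_def emeasure_eq_ennreal_measure)
  qed
  have m_nonneg: "0 \<le> m t" for t
    by (simp add: m_def)
  have m_bound: "m t * t powr p \<le> L" if t: "0 < t" for t
    using markov[OF t] m[OF t] m_nonneg[of t]
    by (simp add: L_def mult.commute flip: ennreal_mult)
  let ?K = "(2 / c) powr (1 + \<theta>) * n powr p"
  have step: "m (2 * t) \<le> ?K * t powr (- p) * m t powr \<theta>" if t: "0 < t" for t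
  proof (cases "m t = 0")
    case True
    have "ennreal (m (2 * t)) \<le> ennreal (m t)"
      using t sets unfolding m[OF t, symmetric] by (subst m[symmetric]) (auto intro!: emeasure_mono)
    with True show ?thesis
      by (simp add: m_nonneg)
  next
    case False
    then obtain r where r: "0 < r" "c * r powr Q = 2 * m t" "r = (2 * m t / c) powr (1 / Q)"
      using ex_radius[of "m t"] m_nonneg[of t] by auto
    define I where "I = (\<integral>\<^sup>+z\<in>{(x, y). d x y < r}.
        ennreal (\<bar>f (fst z) - f (snd z)\<bar> powr p) \<partial>(M \<Otimes>\<^sub>M M))"
    have "ennreal (1 / r powr (\<delta> + Q / p)) * ennreal_powr I (1 / p) \<le> ennreal n"
      unfolding n(1)[symmetric] I_def using r by (intro SUP_upper) auto
    then have "I \<le> ennreal ((n / (1 / r powr (\<delta> + Q / p))) powr p)"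
      using r n p by (intro le_of_ennreal_powr_le) auto
    moreover have "(n / (1 / r powr (\<delta> + Q / p))) powr p = n powr p * (2 * m t / c) powr (1 + \<theta>)"
    proof -
      \<comment> \<open>Equivalently \<open>p * \<delta> + Q = Q * (1 + \<theta>)\<close>, and
        \<open>r powr Q\<close> equals \<open>2 * m t / c\<close>.\<close>
      have "1 / Q * (\<delta> + Q / p) * p = 1 + \<theta>"
        using p Q_pos by (simp add: \<theta>_def field_simps)
      then have "(r powr (\<delta> + Q / p)) powr p = (2 * m t / c) powr (1 + \<theta>)"
        by (simp only: r(3) powr_powr)
      then show ?thesis
        by (simp add: powr_mult)
    qed
    moreover have "ennreal (t powr p * m t * m (2 * t)) \<le> I"
      using superlevel_le[OF f_meas, of p t r] t r p m[of t] m[of "2 * t"] m_nonneg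
      by (simp add: I_def flip: ennreal_mult)
    ultimately have "ennreal (t powr p * m t * m (2 * t))
        \<le> ennreal (n powr p * (2 * m t / c) powr (1 + \<theta>))"
      by (metis order_trans)
    then have "t powr p * m t * m (2 * t) \<le> n powr p * (2 * m t / c) powr (1 + \<theta>)"
      by (simp add: ennreal_le_iff)
    also have "(2 * m t / c) powr (1 + \<theta>) = (2 / c) powr (1 + \<theta>) * (m t * m t powr \<theta>)"
      using m_nonneg[of t] False c_pos powr_mult[of "2 / c" "m t"] by (simp add: powr_add)
    finally show ?thesis
      using False m_nonneg[of t] t by (simp add: powr_minus field_simps)
  qed
  have s0: "0 < s" using s False by simp
  have "s powr q * m s \<le> (2 powr q * ?K) powr (1 / (1 - \<theta>))"
    using \<theta> p q\<theta> step m_bound m_nonneg s0 by (intro weak_type_iteration[where p = p and L = L]) auto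
  then have "(s powr q * m s) powr (1 / q) \<le> ((2 powr q * ?K) powr (1 / (1 - \<theta>))) powr (1 / q)"
    using p \<theta> m_nonneg by (intro powr_mono2) (auto simp: q\<theta>)
  \<comment> \<open>Since \<open>q * (1 - \<theta>) = p\<close>, the outer powers combine to
    \<open>1 / p\<close>, which also turns \<open>n powr p\<close> into \<open>n\<close>.\<close>
  then have "s * m s powr (1 / q) \<le> ?A powr (1 / p) * n"
    using s0 p \<theta> n m_nonneg c_pos
    by (simp add: powr_mult powr_powr q\<theta> \<theta>_def[symmetric] mult.assoc)
  then show ?thesis
    using s0 n m[OF s0] m_nonneg by (simp add: ennreal_leI flip: ennreal_mult)
qed

end

section \<open>From the Dirichlet space to volume growth\<close>

theorem proposition5p1:
  fixes M :: "'a::topological_space measure"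
    and E :: "('a \<Rightarrow> real) \<Rightarrow> ('a \<Rightarrow> real) \<Rightarrow> real"
    and F :: "('a \<Rightarrow> real) set"
    and d :: "'a \<Rightarrow> 'a \<Rightarrow> real"
    and Q C\<^sub>1 :: real
  assumes "separable_space (euclidean :: 'a topology)"
    and "locally_compact_space (euclidean :: 'a topology)"
    and "radon_measure M"
    and "full_support M"
    and "dirichlet_form M E F"
    and "regular_form M E F"
    and "strongly_local_form M E F"
    and "strictly_local_form M E F"
    and "d = intrinsic_dist M E F"
    and "Metric_space.mcomplete UNIV d"
    and "volume_doubling M d"
    and "poincare_inequality_2 M E F d"
    and "Q > 0"
    and "C\<^sub>1 > 0"
    and "\<And>x r. r \<ge> 0 \<Longrightarrow> emeasure M (dball d x r) \<ge> ennreal (C\<^sub>1 * r powr Q)"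
  shows "(\<forall>h \<delta> p q. heat_kernel M E F h \<and> 0 < \<delta> \<and> \<delta> < Q \<and> 1 \<le> p \<and> p < Q / \<delta> \<and>
              q = p * Q / (Q - p * \<delta>) \<longrightarrow>
            (\<exists>C>0. \<forall>f\<in>besov_space M h p (\<delta> / 2).
               (SUP s\<in>{0..}. ennreal s *
                  ennreal_powr (emeasure M {x. \<bar>f x\<bar> \<ge> s}) (1 / q))
               \<le> ennreal C *
                  (SUP r\<in>{0<..}. ennreal (1 / r powr (\<delta> + Q / p)) *
                     ennreal_powr
                       (\<integral>\<^sup>+z\<in>{(x, y). d x y < r}.
                          ennreal (\<bar>f (fst z) - f (snd z)\<bar> powr p) \<partial>(M \<Otimes>\<^sub>M M))
                       (1 / p)))) \<and>
         (\<forall>\<delta>. 0 < \<delta> \<and> \<delta> < Q \<longrightarrow>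
            (\<exists>C>0. \<forall>A\<in>sets M. emeasure M A < \<infinity> \<longrightarrow>
               ennreal_powr (emeasure M A) ((Q - \<delta>) / Q)
               \<le> ennreal C *
                  (SUP r\<in>{0<..}. ennreal (1 / r powr (\<delta> + Q)) *
                     emeasure (M \<Otimes>\<^sub>M M) {(x, y). x \<in> A \<and> y \<in> - A \<and> d x y \<le> r})))"
proof -
  have sets_M: "sets M = sets borel"
    using assms(3) by (simp add: radon_measure_def)
  then have space_M: "space M = UNIV"
    using sets_eq_imp_space_eq by force
  \<comment> \<open>Strict locality identifies the metric topology with the given one, so balls are
    Borel sets and separability passes to the metric.\<close>
  have d: "Metric_space UNIV d" and top: "Metric_space.mtopology UNIV d = euclidean"
    using assms(8,9) by (auto simp: strictly_local_form_def)
  interpret Metric_space UNIV d by fact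
  have ball_sets: "mball x r \<in> sets M" for x r
    using openin_mball[of x r] by (simp add: top sets_M)
  have "sigma_finite_measure M"
    using assms(2,3) d top assms(11) by (rule sigma_finite_measure_doubling)
  moreover have "(\<lambda>z. d (fst z) (snd z)) \<in> borel_measurable (M \<Otimes>\<^sub>M M)"
    using d space_M assms(1) ball_sets
    by (intro Metric_space_borel_measurable_pair) (simp_all add: top)
  moreover have "ennreal (C\<^sub>1 * r powr Q) \<le> emeasure M {y. d x y < r}" if "0 \<le> r" for x r
    using assms(15)[OF that, of x] by (simp add: mball_def)
  ultimately interpret volume_growth M d Q C\<^sub>1
    using assms(13,14) space_M by (simp add: volume_growth_def volume_growth_axioms_def)
  show ?thesis
  proof (intro conjI allI impI; (elim conjE)?)
    fix h \<delta> p q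
    assume \<delta>p: "0 < \<delta>" "\<delta> < Q" "1 \<le> p" "p < Q / \<delta>" "q = p * Q / (Q - p * \<delta>)"
    show "\<exists>C>0. \<forall>f\<in>besov_space M h p (\<delta> / 2).
        (SUP s\<in>{0..}. ennreal s * ennreal_powr (emeasure M {x. \<bar>f x\<bar> \<ge> s}) (1 / q))
        \<le> ennreal C *
          (SUP r\<in>{0<..}. ennreal (1 / r powr (\<delta> + Q / p)) *
             ennreal_powr
               (\<integral>\<^sup>+z\<in>{(x, y). d x y < r}.
                  ennreal (\<bar>f (fst z) - f (snd z)\<bar> powr p) \<partial>(M \<Otimes>\<^sub>M M))
               (1 / p))"
      \<comment> \<open>The witness depends only on \<open>p\<close>, \<open>\<delta>\<close>,
        \<open>Q\<close> and \<open>C\<^sub>1\<close>, so it is uniform in \<open>f\<close>;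
        membership in the Besov space supplies \<open>f \<in> Lp M p\<close>.\<close>
      using weak_sobolev[OF \<delta>p] assms(14)
      by (intro exI[of _ "(2 powr q * (2 / C\<^sub>1) powr (1 + p * \<delta> / Q)) powr (1 / p)"] conjI ballI
          SUP_least) (auto simp: besov_space_def)
  next
    fix \<delta>
    assume \<delta>: "0 < \<delta>" "\<delta> < Q"
    show "\<exists>C>0. \<forall>A\<in>sets M. emeasure M A < \<infinity> \<longrightarrow>
        ennreal_powr (emeasure M A) ((Q - \<delta>) / Q)
        \<le> ennreal C *
          (SUP r\<in>{0<..}. ennreal (1 / r powr (\<delta> + Q)) *
             emeasure (M \<Otimes>\<^sub>M M) {(x, y). x \<in> A \<and> y \<in> - A \<and> d x y \<le> r})"
      using isoperimetric[OF \<delta>] assms(14)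
      by (intro exI[of _ "(2 / C\<^sub>1) powr (1 + \<delta> / Q)"]) auto
  qed
qed

end
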